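(* Let $p\ge 1$, $\sigma>0$, $C_0>0$. Let $f$ be a B--almost periodic function on $\mathbb{R}^p$ which extends to $\mathbb{C}^p$ as an entire function satisfying $$|f(z)|\le C_0 e^{\sigma|z|}\qquad\text{for all } z\in\mathbb{C}^p.$$ Then $\mathrm{sp}\, f\subset \{\lambda\in\mathbb{R}^p: |\lambda|\le\sigma\}$, i.e. $a(\lambda,f)=0$ for every $\lambda\in\mathbb{R}^p$ with $|\lambda|>\sigma$.
   Context: $|z|$ and $|x|$ denote the Euclidean norms on $\mathbb{C}^p$ and $\mathbb{R}^p$; $\langle x,y\rangle$ is the inner product on $\mathbb{R}^p$. The Besicovitch norm of a locally integrable $f$ on $\mathbb{R}^p$ is $\|f\|_B=\limsup_{T\to\infty}(2T)^{-p}\int_{[-T,T]^p}|f(x)|\,dx$. A function $f$ is B--almost periodic on $\mathbb{R}^p$ if for every $\varepsilon>0$ there is a generalized trigonometric polynomial $P(x)=\sum_{n} c_n e^{i\langle x,\lambda^{(n)}\rangle}$ (finite sum, $c_n\in\mathbb{C}$, $\lambda^{(n)}\in\mathbb{R}^p$) with $\|f-P\|_B<\varepsilon$. The Fourier coefficient of such $f$ at $\lambda\in\mathbb{R}^p$ is $a(\lambda,f)=\lim_{T\to\infty}(2T)^{-p}\int_{[-T,T]^p}f(x)e^{-i\langle x,\lambda\rangle}\,dx$ (this limit exists for B--almost periodic $f$), and the spectrum is $\mathrm{sp}\, f=\{\lambda\in\mathbb{R}^p: a(\lambda,f)\ne 0\}$. *)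

theory Defs
  imports "HOL-Analysis.Analysis"
begin

definition cube :: "real \<Rightarrow> (real ^ 'n) set" where
  "cube T = cbox (\<chi> i. - T) (\<chi> i. T)"

text \<open>Besicovitch (semi)norm, as an extended real (the limsup may be infinite).\<close>
definition besicovitch_norm :: "(real ^ 'n \<Rightarrow> complex) \<Rightarrow> ereal" where
  "besicovitch_norm f =
     Limsup at_top (\<lambda>T::real. ereal (integral (cube T) (\<lambda>x. cmod (f x)) / (2 * T) ^ CARD('n)))"

definition trig_poly :: "(real ^ 'n \<Rightarrow> complex) \<Rightarrow> bool" where
  "trig_poly P \<longleftrightarrow> (\<exists>S c. finite (S :: (real ^ 'n) set) \<and>
      P = (\<lambda>x. \<Sum>l\<in>S. c l * exp (\<i> * complex_of_real (x \<bullet> l))))"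

definition B_almost_periodic :: "(real ^ 'n \<Rightarrow> complex) \<Rightarrow> bool" where
  "B_almost_periodic f \<longleftrightarrow>
     (\<forall>a b. f absolutely_integrable_on cbox a b) \<and>
     (\<forall>\<epsilon>>0. \<exists>P. trig_poly P \<and> besicovitch_norm (\<lambda>x. f x - P x) < ereal \<epsilon>)"

definition fourier_coeff :: "real ^ 'n \<Rightarrow> (real ^ 'n \<Rightarrow> complex) \<Rightarrow> complex" where
  "fourier_coeff l f = Lim at_top (\<lambda>T::real.
      integral (cube T) (\<lambda>x. f x * exp (- \<i> * complex_of_real (x \<bullet> l))) / of_real ((2 * T) ^ CARD('n)))"

definition spectrum_ap :: "(real ^ 'n \<Rightarrow> complex) \<Rightarrow> (real ^ 'n) set" where
  "spectrum_ap f = {l. fourier_coeff l f \<noteq> 0}"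

text \<open>Entire function on C^p: complex (Frechet) differentiable everywhere,
  i.e. real Frechet derivative exists and is C-linear.\<close>
definition entire_several :: "(complex ^ 'n \<Rightarrow> complex) \<Rightarrow> bool" where
  "entire_several F \<longleftrightarrow> (\<forall>z. \<exists>L. (F has_derivative L) (at z) \<and>
       (\<forall>c w. L (\<chi> i. c * w $ i) = c * L w))"

definition complexify :: "real ^ 'n \<Rightarrow> complex ^ 'n" where
  "complexify x = (\<chi> i. complex_of_real (x $ i))"

end

theory Submission
  imports Defs "HOL-Complex_Analysis.Complex_Analysis" "HOL-Real_Asymp.Real_Asymp"
begin

text \<open>
  Fix \<open>l\<close> with \<open>|l| > \<sigma>\<close> and a small box \<open>Q\<close> around \<open>l\<close>, and consider
  \<open>I(t) = \<integral>\<^sub>Q f(t v) exp(-i t \<langle>v, l\<rangle>) dv\<close>. Approximating \<open>f\<close> by trigonometric polynomials shows that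
  \<open>I(t)\<close> tends to \<open>vol(Q) a(l, f)\<close> as \<open>t \<rightarrow> \<infinity>\<close>. On the other hand \<open>I\<close> extends to an entire function of
  exponential type, and since \<open>\<langle>v, l\<rangle> > \<sigma> |v|\<close> on \<open>Q\<close> it decays exponentially on a ray
  \<open>arg t = -\<phi>\<close> with \<open>\<phi> < \<pi>/2\<close>. Integrating \<open>I\<close> against the weight \<open>exp(-\<epsilon> t\<^sup>a)\<close> with
  \<open>1 < a < \<pi>/(2\<phi>)\<close>, which beats the exponential growth in the whole sector, and rotating the contour
  to that ray bounds the weighted integral independently of \<open>\<epsilon>\<close>. The weights have mass tending to
  infinity as \<open>\<epsilon> \<rightarrow> 0\<close>, so the limit of \<open>I\<close> must be zero.
\<close>

section \<open>Contour shift in a horizontal strip\<close>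

text \<open>Cauchy's theorem for a rectangle, obtained from a primitive \<open>H\<close> of
  \<open>h\<close>: each horizontal integral is a difference of values of \<open>H\<close>, so the
  two integrals differ only by the increments of \<open>H\<close> along the vertical sides of length
  \<phi>.\<close>

lemma integral_entire_shift_bound:
  fixes h :: "complex \<Rightarrow> complex"
  assumes h: "h holomorphic_on UNIV" and ab: "a \<le> b" and \<phi>: "0 \<le> \<phi>"
    and e: "\<And>y. -\<phi> \<le> y \<Longrightarrow> y \<le> 0 \<Longrightarrow> norm (h (Complex a y)) \<le> e"
    and e': "\<And>y. -\<phi> \<le> y \<Longrightarrow> y \<le> 0 \<Longrightarrow> norm (h (Complex b y)) \<le> e'"
  shows "norm (integral {a..b} (\<lambda>x. h (of_real x)))
    \<le> \<phi> * e + \<phi> * e' + norm (integral {a..b} (\<lambda>x. h (Complex x (-\<phi>))))"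
proof -
  obtain H where H: "\<And>z. (H has_field_derivative h z) (at z)"
    using holomorphic_convex_primitive'[OF convex_UNIV open_UNIV h] by auto
  have int: "integral {a..b} (\<lambda>x. h (Complex x y)) = H (Complex b y) - H (Complex a y)" for y
  proof (rule integral_unique, rule fundamental_theorem_of_calculus[OF ab])
    fix x
    have "((\<lambda>x. Complex x y) has_vector_derivative 1) (at x within {a..b})"
      unfolding complex_eq_iff Complex_eq by (auto intro!: derivative_eq_intros)
    from field_vector_diff_chain_within[OF this has_field_derivative_at_within[OF H]]
    show "((\<lambda>x. H (Complex x y)) has_vector_derivative h (Complex x y)) (at x within {a..b})"
      by (simp add: o_def)
  qed
  have vert: "norm (H (Complex x 0) - H (Complex x (-\<phi>))) \<le> \<phi> * d"
    if d: "\<And>y. -\<phi> \<le> y \<Longrightarrow> y \<le> 0 \<Longrightarrow> norm (h (Complex x y)) \<le> d" for x d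
  proof -
    let ?S = "closed_segment (Complex x (-\<phi>)) (Complex x 0)"
    have S: "\<exists>y. z = Complex x y \<and> -\<phi> \<le> y \<and> y \<le> 0" if z: "z \<in> ?S" for z
      using z \<phi> by (cases z) (auto simp: closed_segment_same_Re closed_segment_eq_real_ivl)
    have "norm (H (Complex x 0) - H (Complex x (-\<phi>))) \<le> d * norm (Complex x 0 - Complex x (-\<phi>))"
    proof (rule field_differentiable_bound[of ?S])
      show "norm (h z) \<le> d" if "z \<in> ?S" for z using S[OF that] d by auto
    qed (auto intro: has_field_derivative_at_within[OF H])
    also have "norm (Complex x 0 - Complex x (-\<phi>)) = \<phi>"
      using \<phi> by (simp add: cmod_def)
    finally show ?thesis by (simp add: mult.commute)
  qed
  have "integral {a..b} (\<lambda>x. h (of_real x)) = H (Complex b 0) - H (Complex a 0)"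
    using int[of 0] by (simp add: complex_of_real_def)
  also have "\<dots> = (H (Complex b 0) - H (Complex b (-\<phi>))) - (H (Complex a 0) - H (Complex a (-\<phi>)))
      + integral {a..b} (\<lambda>x. h (Complex x (-\<phi>)))"
    unfolding int by simp
  also have "norm \<dots> \<le> norm (H (Complex b 0) - H (Complex b (-\<phi>))) + norm (H (Complex a 0) - H (Complex a (-\<phi>)))
      + norm (integral {a..b} (\<lambda>x. h (Complex x (-\<phi>))))"
    by (meson norm_triangle_ineq norm_triangle_ineq4 order_trans add_right_mono)
  also have "\<dots> \<le> \<phi> * e + \<phi> * e' + norm (integral {a..b} (\<lambda>x. h (Complex x (-\<phi>))))"
    using vert[OF e] vert[OF e'] by simp
  finally show ?thesis .
qed

text \<open>Controls the vertical side of the strip far to the right, that is, the large arc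
  \<open>|t| = exp x\<close>. Since \<open>a > 1\<close>, the term \<open>exp (a * x)\<close>
  outweighs \<open>B * exp x\<close> for every \<open>B\<close>.\<close>

lemma exp_exp_damped_at_top_tendsto_0:
  fixes a B e :: real assumes "a > 1" "e > 0"
  shows "((\<lambda>x. exp (B * exp x + x - e * exp (a * x))) \<longlongrightarrow> 0) at_top"
  using assms by real_asymp

text \<open>The counterpart for the small arc \<open>|t| = exp (-x)\<close>: the Jacobian
  contributes \<open>exp (-x)\<close>, while the remaining exponents tend to 0.\<close>

lemma exp_exp_damped_at_bot_tendsto_0:
  fixes a B e :: real assumes "a > 1" "e > 0" 
  shows "((\<lambda>x. exp (B * exp (-x) - x - e * exp (a * (-x)))) \<longlongrightarrow> 0) at_top"
  using assms by real_asymp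

text \<open>With \<open>t = exp x\<close> this is the integral of \<open>exp (-\<eta> * t)\<close>
  over part of the positive half-line, whence a bound free of \<open>R\<close>.\<close>

lemma integral_exp_exp_le:
  fixes \<eta> R :: real
  assumes \<eta>: "\<eta> > 0" and R: "R \<ge> 0"
  shows "integral {-R..R} (\<lambda>x. exp x * exp (- \<eta> * exp x)) \<le> 1 / \<eta>"
proof -
  have "integral {-R..R} (\<lambda>x. exp x * exp (-\<eta> * exp x))
     = - (1 / \<eta>) * exp (-\<eta> * exp R) - (- (1 / \<eta>) * exp (-\<eta> * exp (-R)))"
    using R \<eta> by (intro integral_unique fundamental_theorem_of_calculus)
      (auto simp: has_real_derivative_iff_has_vector_derivative[symmetric] intro!: derivative_eq_intros)
  also have "\<dots> \<le> 1 / \<eta>"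
  proof -
    have "1 / \<eta> * exp (-\<eta> * exp (-R)) \<le> 1 / \<eta> * 1" using \<eta> by (intro mult_left_mono) auto
    moreover have "0 \<le> 1 / \<eta> * exp (-\<eta> * exp R)" using \<eta> by auto
    ultimately show ?thesis by simp
  qed
  finally show ?thesis .
qed

text \<open>The sector is parametrised by \<open>t = exp u\<close>, which turns it into a strip and \<open>t\<^sup>a\<close> into \<open>exp (a u)\<close>.\<close>
lemma norm_sector_weighted_integral_le:
  fixes G :: "complex \<Rightarrow> complex"
  assumes G: "G holomorphic_on UNIV"
    and growth: "\<And>t. norm (G t) \<le> C * exp (B * norm t)"
    and decay: "\<And>r. r > 0 \<Longrightarrow> norm (G (of_real r * cis (-\<phi>))) \<le> C * exp (-\<eta> * r)"
    and \<phi>: "0 \<le> \<phi>" "a * \<phi> < pi / 2" and a: "a > 0" and \<eta>: "\<eta> > 0" and \<epsilon>: "\<epsilon> > 0" and R: "R \<ge> 0"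
  defines "E \<equiv> \<lambda>x. C * exp (B * exp x + x - \<epsilon> * cos (a * \<phi>) * exp (a * x))"
  shows "norm (integral {-R..R} (\<lambda>x. G (of_real (exp x)) * of_real (exp x * exp (- \<epsilon> * exp (a * x)))))
     \<le> \<phi> * E (-R) + \<phi> * E R + C / \<eta>"
proof -
  \<comment> \<open>The first factor \<open>exp u\<close> is the Jacobian of
    \<open>t = exp u\<close>. The weight is written with \<open>exp (of_real a * u)\<close> in place
    of a power of \<open>t\<close>, so that \<open>h\<close> is entire and no branch has to be
    chosen.\<close>
  define h where "h u = G (exp u) * (exp u * exp (- of_real \<epsilon> * exp (of_real a * u)))" for u
  have C: "C \<ge> 0" using order_trans[OF norm_ge_zero growth[of 0]] by simp
  have h: "h holomorphic_on UNIV"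
  proof -
    have "(\<lambda>u. G (exp u)) holomorphic_on UNIV"
      using holomorphic_on_compose_gen[OF holomorphic_on_exp G, of UNIV] by (simp add: o_def)
    then show ?thesis unfolding h_def by (intro holomorphic_intros)
  qed
  have exp_C: "exp (Complex x y) = of_real (exp x) * cis y" for x y
    by (simp add: exp_eq_polar)
  have nrm: "norm (h (Complex x y)) = norm (G (of_real (exp x) * cis y)) * exp x * exp (- \<epsilon> * (exp (a * x) * cos (a * y)))" for x y
    unfolding h_def exp_C by (simp add: norm_mult exp_eq_polar)
  \<comment> \<open>Cosine decreases on \<open>[0, pi]\<close>, so the damping is weakest at the
    extreme angle \<phi>; the bound there serves the whole vertical side.\<close>
  have edge: "norm (h (Complex x y)) \<le> E x" if y: "-\<phi> \<le> y" "y \<le> 0" for x y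
  proof -
    have "cos (a * \<phi>) \<le> cos (a * (-y))"
    proof (rule cos_monotone_0_pi_le)
      show "0 \<le> a * (-y)" using y a by (simp add: mult_le_0_iff)
      show "a * (-y) \<le> a * \<phi>" using y a by (intro mult_left_mono) auto
      show "a * \<phi> \<le> pi" using \<phi> pi_gt_zero by linarith
    qed
    then have c: "cos (a * \<phi>) \<le> cos (a * y)" by simp
    have "norm (h (Complex x y)) \<le> (C * exp (B * exp x)) * exp x * exp (- \<epsilon> * (exp (a * x) * cos (a * \<phi>)))"
      unfolding nrm
    proof (intro mult_mono)
      show "norm (G (of_real (exp x) * cis y)) \<le> C * exp (B * exp x)"
        using growth[of "of_real (exp x) * cis y"] by (simp add: norm_mult)
    qed (use c \<epsilon> C in auto)
    also have "\<dots> = E x" by (simp add: E_def exp_add[symmetric] algebra_simps)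
    finally show ?thesis .
  qed
  have "norm (integral {-R..R} (\<lambda>x. h (Complex x (-\<phi>)))) \<le> integral {-R..R} (\<lambda>x. C * (exp x * exp (-\<eta> * exp x)))"
  proof (rule integral_norm_bound_integral)
    show "(\<lambda>x. h (Complex x (-\<phi>))) integrable_on {-R..R}"
      by (intro integrable_continuous_real continuous_on_compose2[OF holomorphic_on_imp_continuous_on[OF h]])
        (auto simp: Complex_eq intro!: continuous_intros)
    show "(\<lambda>x. C * (exp x * exp (-\<eta> * exp x))) integrable_on {-R..R}"
      by (intro integrable_continuous_real continuous_intros)
    fix x
    \<comment> \<open>On the ray the weight has modulus at most 1, so the decay of \<open>G\<close>
      alone gives a bound that does not depend on \<epsilon>.\<close>
    have "0 \<le> cos (a * \<phi>)" using \<phi> a by (intro cos_ge_zero) (auto intro: order_trans[of _ 0])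
    then have "norm (h (Complex x (-\<phi>))) \<le> (C * exp (-\<eta> * exp x)) * exp x * 1"
      unfolding nrm using decay[of "exp x"] \<epsilon> C by (intro mult_mono) auto
    then show "norm (h (Complex x (-\<phi>))) \<le> C * (exp x * exp (-\<eta> * exp x))" by (simp add: mult_ac)
  qed
  also have "\<dots> = C * integral {-R..R} (\<lambda>x. exp x * exp (-\<eta> * exp x))"
    by simp
  also have "\<dots> \<le> C / \<eta>"
    using mult_left_mono[OF integral_exp_exp_le[OF \<eta> R] C] by simp
  finally have low: "norm (integral {-R..R} (\<lambda>x. h (Complex x (-\<phi>)))) \<le> C / \<eta>" .
  have "norm (integral {-R..R} (\<lambda>x. h (of_real x))) \<le> \<phi> * E (-R) + \<phi> * E R + C / \<eta>"
    using integral_entire_shift_bound[OF h _ \<phi>(1) edge edge, of "-R" R] low R by auto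
  also have "(\<lambda>x. h (of_real x)) = (\<lambda>x. G (of_real (exp x)) * of_real (exp x * exp (- \<epsilon> * exp (a * x))))"
    by (simp add: h_def exp_of_real [symmetric] fun_eq_iff)
  finally show ?thesis .
qed

section \<open>Asymptotic means of functions decaying on a ray\<close>

text \<open>Weights of arbitrarily large mass give weighted integrals of the mean that stay below a
  fixed bound, which is incompatible with the mean staying within \<delta> of some \<open>c\<close>
  with \<open>norm c > \<delta>\<close>. The tolerance \<delta> is kept because almost periodicity
  is used through polynomials that approximate only up to an error.\<close>

lemma norm_asymptotic_mean_le:
  fixes G :: "'v::euclidean_space \<Rightarrow> complex \<Rightarrow> complex"
  assumes cont: "continuous_on (cbox p q \<times> UNIV) (\<lambda>(v, t). G v (complex_of_real t))"
    and holo: "\<And>v. v \<in> cbox p q \<Longrightarrow> G v holomorphic_on UNIV"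
    and growth: "\<And>v t. v \<in> cbox p q \<Longrightarrow> norm (G v t) \<le> C * exp (B * norm t)"
    and decay: "\<And>v r. v \<in> cbox p q \<Longrightarrow> r > 0 \<Longrightarrow>
        norm (G v (of_real r * cis (-\<phi>))) \<le> C * exp (-\<eta> * r)"
    and \<phi>: "0 < \<phi>" "\<phi> < pi / 2" and \<eta>: "\<eta> > 0"
    and ev: "eventually (\<lambda>t. norm (integral (cbox p q) (\<lambda>v. G v (complex_of_real t)) - c) \<le> \<delta>) at_top"
  shows "norm c \<le> \<delta>"
proof (rule ccontr)
  assume "\<not> norm c \<le> \<delta>"
  then have pos: "norm c - \<delta> > 0" by simp
  define J where "J t = integral (cbox p q) (\<lambda>v. G v (complex_of_real t))" for t
  have contJ: "continuous_on UNIV J"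
    unfolding J_def
  proof (rule integral_continuous_on_param)
    have "continuous_on (UNIV \<times> cbox p q) (\<lambda>z. (\<lambda>(v, t). G v (complex_of_real t)) (snd z, fst z))"
      by (rule continuous_on_compose2[OF cont]) (auto intro!: continuous_intros)
    then show "continuous_on (UNIV \<times> cbox p q) (\<lambda>(t, v). G v (complex_of_real t))"
      by (simp add: split_beta')
  qed
  obtain T where T: "T > 0" "\<And>t. t \<ge> T \<Longrightarrow> norm (J t - c) \<le> \<delta>"
  proof -
    obtain T0 where "\<And>t. t \<ge> T0 \<Longrightarrow> norm (J t - c) \<le> \<delta>"
      using ev[folded J_def] unfolding eventually_at_top_linorder by auto
    then show ?thesis using that[of "max T0 1"] by auto
  qed
  obtain D where D: "D \<ge> 0" "\<And>t. t \<in> {0..T} \<Longrightarrow> norm (J t - c) \<le> D"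
  proof -
    have "compact ((\<lambda>t. J t - c) ` {0..T})"
      by (intro compact_continuous_image continuous_intros continuous_on_subset[OF contJ]) auto
    then obtain D where "D > 0" "\<And>z. z \<in> (\<lambda>t. J t - c) ` {0..T} \<Longrightarrow> norm z \<le> D"
      using bounded_pos compact_imp_bounded by metis
    then show ?thesis using that[of D] by auto
  qed
  have \<delta>: "\<delta> \<ge> 0" using T(2)[of T] norm_ge_zero order_trans by blast
  \<comment> \<open>The window for \<open>a\<close>: above 1 to beat growth of order one, below
    \<open>pi / (2 * \<phi>)\<close> so that the weight still decays throughout the sector.\<close>
  have "1 < pi / (2 * \<phi>)" using \<phi> by (simp add: field_simps)
  then obtain a where a: "1 < a" "a < pi / (2 * \<phi>)" using dense by blast
  then have a\<phi>: "a * \<phi> < pi / 2" using \<phi> by (simp add: field_simps)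
  have cos_pos: "cos (a * \<phi>) > 0" using a\<phi> a \<phi> by (intro cos_gt_zero_pi) (auto intro: order.strict_trans[of _ 0])
  \<comment> \<open>The order of the choices matters: \<open>V\<close> and \<open>N\<close> involve
    neither \<epsilon> nor \<open>R\<close>; then \<open>X\<close> is taken large in terms of
    \<open>N\<close>, \<epsilon> in terms of \<open>X\<close>, and \<open>R\<close> in terms of
    \<epsilon>. The summand 1 in \<open>V\<close> makes room for the two vertical sides.\<close>
  define V where "V = integral (cbox p q) (\<lambda>_. 1 + C / \<eta>)"
  define N where "N = V + D * exp 1 * T"
  obtain X where X: "X \<ge> 0" "(norm c - \<delta>) * ((exp X - 1) / exp 1) > N"
  proof -
    have "filterlim (\<lambda>X::real. (norm c - \<delta>) * ((exp X - 1) / exp 1)) at_top at_top"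
      using pos by real_asymp
    then have "eventually (\<lambda>X. (norm c - \<delta>) * ((exp X - 1) / exp 1) > N) at_top"
      by (simp add: filterlim_at_top_dense)
    then have "eventually (\<lambda>X. X \<ge> 0 \<and> (norm c - \<delta>) * ((exp X - 1) / exp 1) > N) at_top"
      using eventually_ge_at_top[of 0] by eventually_elim auto
    then show ?thesis using that eventually_happens'[OF trivial_limit_at_top_linorder] by blast
  qed
  \<comment> \<open>This value gives \<open>\<epsilon> * exp (a * x) \<le> 1\<close> for
    \<open>x \<le> X\<close>, so \<open>w x\<close> is at least \<open>exp x / exp 1\<close> on
    \<open>{0..X}\<close> and the mass of \<open>w\<close> is at least
    \<open>(exp X - 1) / exp 1\<close>.\<close>
  define \<epsilon> where "\<epsilon> = exp (- a * X)"
  define w where "w x = exp x * exp (- \<epsilon> * exp (a * x))" for x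
  have \<epsilon>: "\<epsilon> > 0" by (simp add: \<epsilon>_def)
  have w0: "w x \<ge> 0" for x by (simp add: w_def)
  have contw: "continuous_on S w" for S unfolding w_def by (intro continuous_intros)
  define E where "E x = C * exp (B * exp x + x - \<epsilon> * cos (a * \<phi>) * exp (a * x))" for x
  have "\<epsilon> * cos (a * \<phi>) > 0" using \<epsilon> cos_pos by simp
  from exp_exp_damped_at_top_tendsto_0[OF a(1) this, of B] exp_exp_damped_at_bot_tendsto_0[OF a(1) this, of B]
  have "((\<lambda>x. \<phi> * E (-x) + \<phi> * E x) \<longlongrightarrow> \<phi> * (C * 0) + \<phi> * (C * 0)) at_top"
    unfolding E_def by (intro tendsto_intros) (simp_all add: mult.assoc)
  then have "eventually (\<lambda>x. \<phi> * E (-x) + \<phi> * E x < 1) at_top"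
    by (intro order_tendstoD) auto
  then have "eventually (\<lambda>x. x \<ge> X \<and> \<phi> * E (-x) + \<phi> * E x < 1) at_top"
    using eventually_ge_at_top[of X] by eventually_elim auto
  then obtain R where R: "R \<ge> X" "\<phi> * E (-R) + \<phi> * E R < 1"
    using eventually_happens'[OF trivial_limit_at_top_linorder] by blast
  have R0: "R \<ge> 0" using R X by simp
  have contg: "continuous_on (cbox (p, -R) (q, R)) (\<lambda>(v, x). G v (of_real (exp x)) * of_real (w x))"
  proof -
    have "continuous_on (cbox (p, -R) (q, R)) (\<lambda>z. (\<lambda>(v, t). G v (complex_of_real t)) (fst z, exp (snd z)))"
      by (rule continuous_on_compose2[OF cont]) (auto intro!: continuous_intros simp: cbox_Pair_eq)
    then have "continuous_on (cbox (p, -R) (q, R)) (\<lambda>z. G (fst z) (of_real (exp (snd z))))"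
      by simp
    moreover have "continuous_on (cbox (p, -R) (q, R)) (\<lambda>z. w (snd z))"
      by (rule continuous_on_compose2[OF contw[of UNIV]]) (auto intro!: continuous_intros)
    ultimately show ?thesis unfolding split_beta' by (intro continuous_intros)
  qed
  \<comment> \<open>Fubini puts the weighted integral inside, where the contour rotation applies to
    each \<open>v\<close> separately with constants common to the whole box.\<close>
  have "norm (integral {-R..R} (\<lambda>x. J (exp x) * of_real (w x))) \<le> V"
  proof -
    have "integral {-R..R} (\<lambda>x. J (exp x) * of_real (w x))
      = integral (cbox (-R) R) (\<lambda>x. integral (cbox p q) (\<lambda>v. G v (of_real (exp x)) * of_real (w x)))"
      by (simp add: J_def)
    also have "\<dots> = integral (cbox p q) (\<lambda>v. integral (cbox (-R) R) (\<lambda>x. G v (of_real (exp x)) * of_real (w x)))"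
      by (rule integral_swap_continuous[OF contg, symmetric])
    also have "norm \<dots> \<le> V"
      unfolding V_def
    proof (rule integral_norm_bound_integral)
      show "(\<lambda>v. integral (cbox (-R) R) (\<lambda>x. G v (of_real (exp x)) * of_real (w x))) integrable_on cbox p q"
        by (intro integrable_continuous integral_continuous_on_param)
          (use contg in \<open>simp add: cbox_Pair_eq\<close>)
      fix v assume v: "v \<in> cbox p q"
      have "norm (integral (cbox (-R) R) (\<lambda>x. G v (of_real (exp x)) * of_real (w x)))
        \<le> \<phi> * E (-R) + \<phi> * E R + C / \<eta>"
        using norm_sector_weighted_integral_le[OF holo[OF v] growth[OF v] decay[OF v] _ a\<phi> _ \<eta> \<epsilon> R0] \<phi> a
        unfolding E_def w_def by simp
      then show "norm (integral (cbox (-R) R) (\<lambda>x. G v (of_real (exp x)) * of_real (w x))) \<le> 1 + C / \<eta>"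
        using R(2) by linarith
    qed (rule integrable_const)
    finally show ?thesis .
  qed
  moreover have "norm (integral {-R..R} (\<lambda>x. (J (exp x) - c) * of_real (w x)))
      \<le> integral {-R..R} (\<lambda>x. \<delta> * w x + D * exp 1 * (exp x * exp (- (1 / T) * exp x)))"
  proof (rule integral_norm_bound_integral)
    show "(\<lambda>x. (J (exp x) - c) * of_real (w x)) integrable_on {-R..R}"
      by (intro integrable_continuous_real continuous_intros contw continuous_on_compose2[OF contJ]) auto
    show "(\<lambda>x. \<delta> * w x + D * exp 1 * (exp x * exp (- (1 / T) * exp x))) integrable_on {-R..R}"
      by (intro integrable_continuous_real continuous_intros contw)
    fix x
    show "norm ((J (exp x) - c) * of_real (w x)) \<le> \<delta> * w x + D * exp 1 * (exp x * exp (- (1 / T) * exp x))"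
    proof (cases "exp x \<ge> T")
      case True
      then have "norm (J (exp x) - c) * w x \<le> \<delta> * w x" using T(2) w0 by (intro mult_right_mono) auto
      then show ?thesis using D(1) w0 by (simp add: norm_mult add_increasing2)
    next
      case False
      \<comment> \<open>Since \<open>exp x < T\<close>, the factor
        \<open>exp 1 * exp (- (1 / T) * exp x)\<close> is at least 1. Inserting it replaces the
        cutoff at \<open>T\<close> by a function whose integral is at most \<open>T\<close> for
        every \<open>R\<close>.\<close>
      have "norm (J (exp x) - c) * w x \<le> D * (exp x * 1)"
        using D False \<epsilon> by (intro mult_mono) (auto simp: w_def)
      also have "\<dots> \<le> D * (exp x * (exp 1 * exp (- (1 / T) * exp x)))"
        using False T(1) D(1) by (intro mult_left_mono) (auto simp: exp_add[symmetric])
      also have "\<dots> = D * exp 1 * (exp x * exp (- (1 / T) * exp x))" by simp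
      also have "\<dots> \<le> \<delta> * w x + \<dots>" using \<delta> w0 by simp
      finally show ?thesis using w0 by (simp add: norm_mult)
    qed
  qed
  moreover have "integral {-R..R} (\<lambda>x. \<delta> * w x + D * exp 1 * (exp x * exp (- (1 / T) * exp x)))
      \<le> \<delta> * integral {-R..R} w + D * exp 1 * T"
  proof -
    have "integral {-R..R} (\<lambda>x. \<delta> * w x + D * exp 1 * (exp x * exp (- (1 / T) * exp x)))
       = \<delta> * integral {-R..R} w + D * exp 1 * integral {-R..R} (\<lambda>x. exp x * exp (- (1 / T) * exp x))"
      using T(1) by (subst integral_add) (auto intro!: integrable_continuous_real continuous_intros contw)
    also have "\<dots> \<le> \<delta> * integral {-R..R} w + D * exp 1 * T"
      using integral_exp_exp_le[of "1 / T" R] T(1) D(1) R0 by (intro add_left_mono mult_left_mono) auto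
    finally show ?thesis .
  qed
  moreover have "integral {-R..R} (\<lambda>x. J (exp x) * of_real (w x)) - integral {-R..R} (\<lambda>x. (J (exp x) - c) * of_real (w x))
     = c * of_real (integral {-R..R} w)"
  proof -
    have "integral {-R..R} (\<lambda>x. J (exp x) * of_real (w x)) - integral {-R..R} (\<lambda>x. (J (exp x) - c) * of_real (w x))
       = integral {-R..R} (\<lambda>x. J (exp x) * of_real (w x) - (J (exp x) - c) * of_real (w x))"
      by (rule integral_diff[symmetric])
        (intro integrable_continuous_real continuous_intros contw continuous_on_compose2[OF contJ]; auto)+
    also have "(\<lambda>x. J (exp x) * of_real (w x) - (J (exp x) - c) * of_real (w x)) = (\<lambda>x. c * of_real (w x))"
      by (simp add: algebra_simps)
    also have "integral {-R..R} \<dots> = c * of_real (integral {-R..R} w)"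
    proof -
      have "((\<lambda>x. complex_of_real (w x)) has_integral of_real (integral {-R..R} w)) {-R..R}"
        by (intro has_integral_of_real integrable_integral integrable_continuous_real contw)
      then show ?thesis by (simp add: integral_unique)
    qed
    finally show ?thesis .
  qed
  moreover have K: "(exp X - 1) / exp 1 \<le> integral {-R..R} w"
  proof -
    have "((\<lambda>x. exp x / exp 1 :: real) has_integral (exp X / exp 1 - exp 0 / exp 1)) {0..X}"
      using X by (intro fundamental_theorem_of_calculus)
        (auto simp: has_real_derivative_iff_has_vector_derivative[symmetric] intro!: derivative_eq_intros)
    then have "(exp X - 1) / exp 1 = integral {0..X} (\<lambda>x. exp x / exp 1 :: real)"
      by (simp only: integral_unique diff_divide_distrib exp_zero)
    also have "\<dots> \<le> integral {0..X} w"
    proof (rule integral_le)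
      fix x assume x: "x \<in> {0..X}"
      have "\<epsilon> * exp (a * x) \<le> 1"
        using x a by (simp add: \<epsilon>_def exp_add[symmetric])
      then show "exp x / exp 1 \<le> w x"
        by (simp add: w_def exp_minus[symmetric] divide_inverse)
    qed (intro integrable_continuous_real continuous_intros contw; simp)+
    also have "\<dots> \<le> integral {-R..R} w"
      using R R0 w0 by (intro integral_subset_le) (auto intro!: integrable_continuous_real contw)
    finally show ?thesis .
  qed
  ultimately have "norm (c * of_real (integral {-R..R} w)) \<le> V + (\<delta> * integral {-R..R} w + D * exp 1 * T)"
    using norm_triangle_ineq4[of "integral {-R..R} (\<lambda>x. J (exp x) * of_real (w x))" "integral {-R..R} (\<lambda>x. (J (exp x) - c) * of_real (w x))"]
    by simp
  moreover have "0 \<le> integral {-R..R} w" using w0 by (intro integral_nonneg integrable_continuous_real contw) 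
  ultimately have "(norm c - \<delta>) * integral {-R..R} w \<le> N"
    by (simp add: norm_mult N_def algebra_simps)
  moreover have "(norm c - \<delta>) * ((exp X - 1) / exp 1) \<le> (norm c - \<delta>) * integral {-R..R} w"
    using K pos by (intro mult_left_mono) auto
  ultimately show False using X(2) by linarith
qed

section \<open>Riemann-Lebesgue lemma on a box\<close>

text \<open>Translating the box by \<open>w T\<close>, half a period of the exponential, flips the sign of the integrand.\<close>
lemma integral_box_exp_tendsto_0:
  fixes \<mu> a b :: "'a::euclidean_space"
  assumes "\<mu> \<noteq> 0"
  shows "((\<lambda>T. integral (cbox a b) (\<lambda>v. exp (\<i> * complex_of_real ((T *\<^sub>R v) \<bullet> \<mu>)))) \<longlongrightarrow> 0) at_top"
proof -
  define e where "e T v = exp (\<i> * complex_of_real ((T *\<^sub>R v) \<bullet> \<mu>))" for T v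
  define w where "w T = (pi / (T * (\<mu> \<bullet> \<mu>))) *\<^sub>R \<mu>" for T :: real
  let ?Q = "cbox a b"
  \<comment> \<open>Equals 1 exactly when one of \<open>v\<close> and \<open>v + w T\<close> lies in
    the box and the other does not, and 0 otherwise.\<close>
  define d where "d T v = norm (indicator ?Q v - indicator ?Q (v + w T) :: real)" for T v
  have norm_e: "norm (e T v) = 1" for T v by (simp add: e_def)
  have e_shift: "e T (v + w T) = - e T v" if "T > 0" for T v
  proof -
    have "(T *\<^sub>R (v + w T)) \<bullet> \<mu> = (T *\<^sub>R v) \<bullet> \<mu> + pi"
      using that assms by (simp add: w_def scaleR_add_right inner_add_left)
    then show ?thesis by (simp add: e_def distrib_left exp_add del: inner_scaleR_left)
  qed
  have meas_e [measurable]: "e T \<in> borel_measurable borel" for T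
    unfolding e_def by (intro borel_measurable_continuous_onI continuous_intros)
  have w_lim: "(w \<longlongrightarrow> 0) at_top"
  proof -
    have "((\<lambda>T::real. pi / (\<mu> \<bullet> \<mu>) * inverse T) \<longlongrightarrow> pi / (\<mu> \<bullet> \<mu>) * 0) at_top"
      by (intro tendsto_intros tendsto_inverse_0_at_top filterlim_ident)
    from tendsto_scaleR[OF this tendsto_const[of \<mu>]]
    have "((\<lambda>T. (pi / (\<mu> \<bullet> \<mu>) * inverse T) *\<^sub>R \<mu>) \<longlongrightarrow> 0) at_top" by simp
    moreover have "w = (\<lambda>T. (pi / (\<mu> \<bullet> \<mu>) * inverse T) *\<^sub>R \<mu>)"
      by (simp add: w_def fun_eq_iff field_simps)
    ultimately show ?thesis by simp
  qed
  have intQ: "integrable lborel (\<lambda>v. indicator ?Q (v + z) *\<^sub>R e T v)" for z T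
  proof -
    have "(\<lambda>v. v + z) -` ?Q = (\<lambda>x. x + (- z)) ` ?Q"
    proof (intro set_eqI iffI)
      fix v assume "v \<in> (\<lambda>v. v + z) -` ?Q"
      then show "v \<in> (\<lambda>x. x + (- z)) ` ?Q" by (intro image_eqI[of _ _ "v + z"]) auto
    qed auto
    then have "bounded ((\<lambda>v. v + z) -` ?Q)"
      using bounded_translation[OF bounded_cbox, of "-z" a b] by (simp add: add.commute)
    moreover have "(\<lambda>v. v + z) -` ?Q \<in> sets lborel"
      using measurable_sets_borel[of "\<lambda>v. v + z" borel ?Q] by simp
    ultimately have "integrable lborel (indicator ((\<lambda>v. v + z) -` ?Q) :: 'a \<Rightarrow> real)"
      by (intro integrable_real_indicator emeasure_bounded_finite) auto
    then show ?thesis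
      by (rule Bochner_Integration.integrable_bound)
        (auto simp: norm_e indicator_def)
  qed
  have int_e: "integral ?Q (e T) = (LBINT v. indicator ?Q v *\<^sub>R e T v)" for T
  proof -
    have "set_integrable lborel ?Q (e T)" using intQ[of 0 T] by (simp add: set_integrable_def)
    from set_borel_integral_eq_integral(2)[OF this]
    show ?thesis by (simp add: set_lebesgue_integral_def)
  qed
  have key: "norm (integral ?Q (e T)) \<le> (LBINT v. d T v)" if T: "T > 0" for T
  proof -
    have "integral ?Q (e T) = (LINT v | distr lborel borel ((+) (w T)). indicator ?Q v *\<^sub>R e T v)"
      unfolding int_e lborel_distr_plus ..
    also have "\<dots> = (LBINT v. indicator ?Q (v + w T) *\<^sub>R e T (v + w T))"
      by (subst integral_distr) (auto simp: add.commute)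
    also have "\<dots> = - (LBINT v. indicator ?Q (v + w T) *\<^sub>R e T v)"
      using T by (simp add: e_shift)
    \<comment> \<open>The integral equals both its original form and minus its translated form;
      adding the two leaves only the symmetric difference of the box and its translate.\<close>
    finally have "2 * integral ?Q (e T)
        = (LBINT v. indicator ?Q (v + 0) *\<^sub>R e T v) - (LBINT v. indicator ?Q (v + w T) *\<^sub>R e T v)"
      using int_e[of T] by simp
    also have "\<dots> = (LBINT v. indicator ?Q (v + 0) *\<^sub>R e T v - indicator ?Q (v + w T) *\<^sub>R e T v)"
      by (rule Bochner_Integration.integral_diff[symmetric]) (rule intQ)+
    also have "norm \<dots> \<le> (LBINT v. norm (indicator ?Q (v + 0) *\<^sub>R e T v - indicator ?Q (v + w T) *\<^sub>R e T v))"
      by (rule integral_norm_bound)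
    also have "\<dots> = (LBINT v. d T v)"
      by (simp add: d_def scaleR_left_diff_distrib[symmetric] norm_e)
    finally have "2 * norm (integral ?Q (e T)) \<le> (LBINT v. d T v)" by (simp add: norm_mult)
    then show ?thesis using norm_ge_zero[of "integral ?Q (e T)"] by linarith
  qed
  have "((\<lambda>T. LBINT v. d T v) \<longlongrightarrow> (LBINT v::'a. 0)) at_top"
  proof -
    obtain M where M: "\<And>x. x \<in> ?Q \<Longrightarrow> norm x \<le> M"
      using bounded_cbox[of a b] unfolding bounded_iff by blast
    \<comment> \<open>Off the frontier the indicator of the box is continuous, so
      \<open>d T v\<close> tends to 0 there; the frontier is a null set.\<close>
    have "AE v in lebesgue. v \<notin> frontier ?Q"
      using negligible_frontier_interval[of a b]
      by (intro AE_not_in) (simp add: negligible_iff_null_sets frontier_cbox)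
    then have ae: "AE v in lborel. v \<notin> frontier ?Q"
      by (simp add: AE_completion_iff)
    show ?thesis
    proof (rule integral_dominated_convergence_at_top)
      show "integrable lborel (indicator (cball 0 (M + 1)) :: 'a \<Rightarrow> real)"
        by (intro integrable_real_indicator emeasure_bounded_finite) auto
      show "AE v in lborel. ((\<lambda>T. d T v) \<longlongrightarrow> 0) at_top"
        using ae
      proof eventually_elim
        case (elim v)
        then have "isCont (indicator ?Q :: 'a \<Rightarrow> real) v" by (simp add: isCont_indicator)
        moreover have "((\<lambda>T. v + w T) \<longlongrightarrow> v + 0) at_top" by (intro tendsto_intros w_lim)
        ultimately have "((\<lambda>T. indicator ?Q (v + w T) :: real) \<longlongrightarrow> indicator ?Q v) at_top"
          using isCont_tendsto_compose[of v "indicator ?Q :: 'a \<Rightarrow> real" "\<lambda>T. v + w T" at_top] by simp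
        from tendsto_norm[OF tendsto_diff[OF tendsto_const[of "indicator ?Q v :: real"] this]]
        show ?case by (simp add: d_def)
      qed
      have "eventually (\<lambda>T. norm (w T) < 1) at_top"
        using tendsto_norm[OF w_lim] by (intro order_tendstoD) auto
      then show "\<forall>\<^sub>F T in at_top. AE v in lborel. norm (d T v) \<le> indicator (cball 0 (M + 1)) v"
      proof eventually_elim
        case (elim T)
        show ?case
        proof (rule AE_I2)
          fix v
          have "norm v \<le> M + 1" if "v + w T \<in> ?Q"
            using M[OF that] elim norm_triangle_ineq4[of "v + w T" "w T"] by simp
          moreover have "norm v \<le> M + 1" if "v \<in> ?Q" using M[OF that] by simp
          ultimately show "norm (d T v) \<le> indicator (cball 0 (M + 1)) v"
            by (auto simp: d_def indicator_def)
        qed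
      qed
    qed (auto simp: d_def)
  qed
  then have "((\<lambda>T. LBINT v. d T v) \<longlongrightarrow> 0) at_top" by simp
  then have "((\<lambda>T. integral ?Q (e T)) \<longlongrightarrow> 0) at_top"
    by (rule Lim_null_comparison[rotated]) (rule eventually_mono[OF eventually_gt_at_top[of 0] key])
  then show ?thesis by (simp add: e_def[abs_def])
qed

section \<open>Means over dilated boxes\<close>

text \<open>The conjugate character of frequency \<open>l\<close> evaluated at
  \<open>x = T v\<close>. Substituting \<open>x = T v\<close> turns means over growing regions into
  integrals over a fixed box.\<close>

definition scaled_char :: "real ^ 'n \<Rightarrow> real \<Rightarrow> real ^ 'n \<Rightarrow> complex" where
  "scaled_char l T v = exp (- \<i> * complex_of_real ((T *\<^sub>R v) \<bullet> l))"

lemma norm_scaled_char [simp]: "norm (scaled_char l T v) = 1"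
  by (simp add: scaled_char_def)

lemma continuous_scaled_char [continuous_intros]: "continuous_on S (scaled_char l T)"
  unfolding scaled_char_def by (intro continuous_intros)

lemma trig_poly_continuous: "trig_poly P \<Longrightarrow> continuous_on S P"
  unfolding trig_poly_def by (auto intro!: continuous_intros)

text \<open>Every frequency other than \<open>l\<close> averages out, leaving the coefficient at
  \<open>l\<close> times the volume. One \<open>c\<close> serves all boxes, which later allows
  passing from a small box to the unit cube.\<close>

lemma trig_poly_box_mean:
  fixes P :: "real ^ 'n \<Rightarrow> complex"
  assumes "trig_poly P"
  shows "\<exists>c. \<forall>a b. ((\<lambda>T. integral (cbox a b) (\<lambda>v. P (T *\<^sub>R v) * scaled_char l T v))
      \<longlongrightarrow> c * of_real (measure lborel (cbox a b))) at_top"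
proof -
  obtain S k where S: "finite S" and P: "P = (\<lambda>x. \<Sum>s\<in>S. k s * exp (\<i> * complex_of_real (x \<bullet> s)))"
    using assms unfolding trig_poly_def by auto
  have lim: "((\<lambda>T. integral (cbox a b) (\<lambda>v. exp (\<i> * complex_of_real ((T *\<^sub>R v) \<bullet> (s - l)))))
      \<longlongrightarrow> (if s = l then of_real (measure lborel (cbox a b)) else 0)) at_top" for s a b
    using integral_box_exp_tendsto_0[of "s - l" a b] by (auto simp: scaleR_conv_of_real)
  have "((\<lambda>T. integral (cbox a b) (\<lambda>v. P (T *\<^sub>R v) * scaled_char l T v))
      \<longlongrightarrow> (\<Sum>s\<in>S. if s = l then k s else 0) * of_real (measure lborel (cbox a b))) at_top" for a b
  proof -
    have "(\<lambda>T. integral (cbox a b) (\<lambda>v. P (T *\<^sub>R v) * scaled_char l T v))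
        = (\<lambda>T. \<Sum>s\<in>S. k s * integral (cbox a b) (\<lambda>v. exp (\<i> * complex_of_real ((T *\<^sub>R v) \<bullet> (s - l)))))"
    proof
      fix T
      have "(\<lambda>v. P (T *\<^sub>R v) * scaled_char l T v)
        = (\<lambda>v. \<Sum>s\<in>S. k s * exp (\<i> * complex_of_real ((T *\<^sub>R v) \<bullet> (s - l))))"
      proof
        fix v
        have "exp (\<i> * complex_of_real ((T *\<^sub>R v) \<bullet> s)) * scaled_char l T v
          = exp (\<i> * complex_of_real ((T *\<^sub>R v) \<bullet> (s - l)))" for s
          by (simp add: scaled_char_def exp_add[symmetric] inner_diff_right algebra_simps)
        then show "P (T *\<^sub>R v) * scaled_char l T v
          = (\<Sum>s\<in>S. k s * exp (\<i> * complex_of_real ((T *\<^sub>R v) \<bullet> (s - l))))"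
          by (simp only: P sum_distrib_right mult.assoc)
      qed
      then show "integral (cbox a b) (\<lambda>v. P (T *\<^sub>R v) * scaled_char l T v)
        = (\<Sum>s\<in>S. k s * integral (cbox a b) (\<lambda>v. exp (\<i> * complex_of_real ((T *\<^sub>R v) \<bullet> (s - l)))))"
        by (simp only:) (subst integral_sum, use S in \<open>auto intro!: integrable_continuous continuous_intros\<close>)
    qed
    moreover have "((\<lambda>T. \<Sum>s\<in>S. k s * integral (cbox a b) (\<lambda>v. exp (\<i> * complex_of_real ((T *\<^sub>R v) \<bullet> (s - l)))))
      \<longlongrightarrow> (\<Sum>s\<in>S. k s * (if s = l then of_real (measure lborel (cbox a b)) else 0))) at_top"
      by (intro tendsto_intros lim)
    moreover have "(\<Sum>s\<in>S. k s * (if s = l then of_real (measure lborel (cbox a b)) else 0))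
       = (\<Sum>s\<in>S. if s = l then k s else 0) * complex_of_real (measure lborel (cbox a b))"
      by (auto simp: sum_distrib_right intro!: sum.cong)
    ultimately show ?thesis by simp
  qed
  then show ?thesis by blast
qed

lemma integral_cube_scale:
  fixes g :: "real ^ 'n \<Rightarrow> 'b::banach"
  assumes "continuous_on UNIV g" "T > 0"
  shows "integral (cube M) (\<lambda>v. g (T *\<^sub>R v)) = integral (cube (T * M)) g /\<^sub>R T ^ CARD('n)"
proof -
  have "(g has_integral integral (cube (T * M)) g) (cube (T * M))"
    unfolding cube_def using assms by (intro integrable_integral integrable_continuous continuous_on_subset[OF assms(1)]) auto
  from has_integral_affinity'[OF this[unfolded cube_def] assms(2), of 0]
  have "((\<lambda>v. g (T *\<^sub>R v)) has_integral (integral (cube (T * M)) g /\<^sub>R T ^ CARD('n)))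
      (cbox ((\<chi> i. - (T * M)) /\<^sub>R T) ((\<chi> i. T * M) /\<^sub>R T))"
    by (simp add: cube_def)
  moreover have "(\<chi> i. - (T * M)) /\<^sub>R T = (\<chi> i. - M :: real ^ 'n)" "(\<chi> i. T * M) /\<^sub>R T = (\<chi> i. M :: real ^ 'n)"
    using assms(2) by (simp_all add: vec_eq_iff)
  ultimately show ?thesis by (simp add: cube_def integral_unique)
qed

text \<open>The character has modulus 1 and the box dilated by \<open>T\<close> lies in
  \<open>cube (T * M)\<close>, so the normalised mean over that cube dominates;
  \<open>(2 * M) ^ CARD('n)\<close> is what remains of the normalisation.\<close>

lemma besicovitch_norm_box_mean_le:
  fixes g :: "real ^ 'n \<Rightarrow> complex"
  assumes g: "continuous_on UNIV g" and B: "besicovitch_norm g < ereal \<epsilon>"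
    and sub: "cbox a b \<subseteq> cube M" and M: "M > 0"
  shows "\<forall>\<^sub>F T in at_top. norm (integral (cbox a b) (\<lambda>v. g (T *\<^sub>R v) * scaled_char l T v)) \<le> (2 * M) ^ CARD('n) * \<epsilon>"
proof -
  have "\<forall>\<^sub>F T in at_top. integral (cube T) (\<lambda>x. cmod (g x)) / (2 * T) ^ CARD('n) < \<epsilon>"
    using Limsup_lessD[OF B[unfolded besicovitch_norm_def]] by simp
  moreover have "filterlim (\<lambda>T. T * M) at_top at_top"
    using M by (intro filterlim_at_top_mult_tendsto_pos[OF tendsto_const] filterlim_ident) 
  ultimately have "\<forall>\<^sub>F T in at_top. integral (cube (T * M)) (\<lambda>x. cmod (g x)) / (2 * (T * M)) ^ CARD('n) < \<epsilon>"
    by (rule eventually_compose_filterlim)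
  then show ?thesis
    using eventually_gt_at_top[of 0]
  proof eventually_elim
    case (elim T)
    have cg: "continuous_on S (\<lambda>v. g (T *\<^sub>R v))" for S
      by (intro continuous_on_compose2[OF g] continuous_intros) auto
    have "norm (integral (cbox a b) (\<lambda>v. g (T *\<^sub>R v) * scaled_char l T v)) \<le> integral (cbox a b) (\<lambda>v. norm (g (T *\<^sub>R v)))"
      by (intro integral_norm_bound_integral integrable_continuous continuous_intros cg) (simp add: norm_mult)
    also have "\<dots> \<le> integral (cube M) (\<lambda>v. norm (g (T *\<^sub>R v)))"
      using sub by (intro integral_subset_le) (auto simp: cube_def intro!: integrable_continuous continuous_intros cg)
    also have "\<dots> = integral (cube (T * M)) (\<lambda>x. norm (g x)) /\<^sub>R T ^ CARD('n)"
      by (rule integral_cube_scale) (use elim g in \<open>auto intro!: continuous_intros\<close>)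
    also have "\<dots> = (2 * M) ^ CARD('n) * (integral (cube (T * M)) (\<lambda>x. norm (g x)) / (2 * (T * M)) ^ CARD('n))"
      using M elim by (simp add: power_mult_distrib field_simps)
    also have "\<dots> \<le> (2 * M) ^ CARD('n) * \<epsilon>"
      using elim M by (intro mult_left_mono) auto
    finally show ?case .
  qed
qed

text \<open>Here \<open>c\<close> is the limit constant of a trigonometric polynomial
  \<open>P\<close> close to \<open>f\<close>, hence depends on \<epsilon> but not on the box. The
  factor 2 adds the error from \<open>f - P\<close> to that from the convergence of the means of
  \<open>P\<close>.\<close>

lemma B_almost_periodic_box_mean:
  fixes f :: "real ^ 'n \<Rightarrow> complex"
  assumes f: "continuous_on UNIV f" "B_almost_periodic f" and \<epsilon>: "\<epsilon> > 0"
  shows "\<exists>c. \<forall>a b M. M > 0 \<longrightarrow> cbox a b \<subseteq> cube M \<longrightarrow>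
     (\<forall>\<^sub>F T in at_top. norm (integral (cbox a b) (\<lambda>v. f (T *\<^sub>R v) * scaled_char l T v) - c * of_real (measure lborel (cbox a b)))
        \<le> 2 * (2 * M) ^ CARD('n) * \<epsilon>)"
proof -
  obtain P where P: "trig_poly P" "besicovitch_norm (\<lambda>x. f x - P x) < ereal \<epsilon>"
    using f(2) \<epsilon> unfolding B_almost_periodic_def by blast
  obtain c where c: "\<And>a b. ((\<lambda>T. integral (cbox a b) (\<lambda>v. P (T *\<^sub>R v) * scaled_char l T v))
      \<longlongrightarrow> c * of_real (measure lborel (cbox a b))) at_top"
    using trig_poly_box_mean[OF P(1)] by blast
  have contP: "continuous_on UNIV P" by (rule trig_poly_continuous[OF P(1)])
  have "\<forall>\<^sub>F T in at_top. norm (integral (cbox a b) (\<lambda>v. f (T *\<^sub>R v) * scaled_char l T v) - c * of_real (measure lborel (cbox a b)))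
        \<le> 2 * (2 * M) ^ CARD('n) * \<epsilon>"
    if M: "M > 0" and sub: "cbox a b \<subseteq> cube M" for a b M
  proof -
    have "(2 * M) ^ CARD('n) * \<epsilon> > 0" using M \<epsilon> by simp
    from tendstoD[OF c this, of a b]
      besicovitch_norm_box_mean_le[OF continuous_on_diff[OF f(1) contP] P(2) sub M, of l]
    show ?thesis
    proof eventually_elim
      case (elim T)
      have cT: "continuous_on S (\<lambda>v. g (T *\<^sub>R v))" if "continuous_on UNIV g" for S and g :: "real ^ 'n \<Rightarrow> complex"
        by (intro continuous_on_compose2[OF that] continuous_intros) auto
      have "integral (cbox a b) (\<lambda>v. f (T *\<^sub>R v) * scaled_char l T v)
        = integral (cbox a b) (\<lambda>v. (f (T *\<^sub>R v) - P (T *\<^sub>R v)) * scaled_char l T v)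
        + integral (cbox a b) (\<lambda>v. P (T *\<^sub>R v) * scaled_char l T v)"
        by (subst integral_add[symmetric])
          ((intro integrable_continuous continuous_intros cT f(1) contP; simp)+, simp add: algebra_simps)
      moreover have "norm (X + Y - Z) \<le> norm X + dist Y Z" for X Y Z :: complex
        by norm
      ultimately have "norm (integral (cbox a b) (\<lambda>v. f (T *\<^sub>R v) * scaled_char l T v) - c * of_real (measure lborel (cbox a b)))
        \<le> norm (integral (cbox a b) (\<lambda>v. (f (T *\<^sub>R v) - P (T *\<^sub>R v)) * scaled_char l T v))
         + dist (integral (cbox a b) (\<lambda>v. P (T *\<^sub>R v) * scaled_char l T v)) (c * of_real (measure lborel (cbox a b)))"
        by presburger
      also have "\<dots> \<le> (2 * M) ^ CARD('n) * \<epsilon> + (2 * M) ^ CARD('n) * \<epsilon>"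
        using elim by (intro add_mono) auto
      finally show ?case by (simp only: mult.assoc mult_2 distrib_right)
    qed
  qed
  then show ?thesis by blast
qed

section \<open>Entire functions on complex lines and at real points\<close>

text \<open>By the chain rule the real derivative at \<open>t\<close> is \<open>L\<close> applied to
  \<open>h w\<close>, and complex linearity of \<open>L\<close> makes this multiplication by
  \<open>L w\<close>.\<close>

lemma entire_several_line:
  fixes F :: "complex ^ 'n \<Rightarrow> complex"
  assumes "entire_several F"
  shows "(\<lambda>t. F (\<chi> i. t * w $ i)) holomorphic_on UNIV"
proof -
  have "(\<lambda>t. F (\<chi> i. t * w $ i)) field_differentiable (at t)" for t
  proof -
    obtain L where L: "(F has_derivative L) (at (\<chi> i. t * w $ i))" "\<And>c w. L (\<chi> i. c * w $ i) = c * L w"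
      using assms unfolding entire_several_def by blast
    have "bounded_linear (\<lambda>h. \<chi> i. h * w $ i)"
      by (intro linear_conv_bounded_linear[THEN iffD1] linearI) (simp_all add: vec_eq_iff algebra_simps)
    then have "((\<lambda>h. \<chi> i. h * w $ i) has_derivative (\<lambda>h. \<chi> i. h * w $ i)) (at t)"
      by (rule bounded_linear_imp_has_derivative)
    from diff_chain_at[OF this L(1)] have "((\<lambda>t. F (\<chi> i. t * w $ i)) has_field_derivative L w) (at t)"
      by (simp add: has_field_derivative_def o_def L(2) mult_commute_abs)
    then show ?thesis unfolding field_differentiable_def by blast
  qed
  then show ?thesis by (simp add: holomorphic_on_def)
qed

lemma entire_several_continuous_complexify:
  assumes "entire_several F"
  shows "continuous_on S (\<lambda>x. F (complexify x))"
proof -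
  have "F differentiable (at z)" for z
    using assms unfolding entire_several_def differentiable_def by blast
  then have "continuous_on UNIV F"
    by (simp add: continuous_at_imp_continuous_on differentiable_imp_continuous_within)
  then show ?thesis
    unfolding complexify_def by (rule continuous_on_compose2) (auto intro!: continuous_intros)
qed

lemma norm_scaled_complexify: "norm (\<chi> i. t * complexify v $ i) = norm t * norm v"
  by (simp add: norm_vec_def complexify_def norm_mult L2_set_right_distrib)

section \<open>Vanishing of the cube means and of the Fourier coefficient\<close>

text \<open>Decay on a ray is available only for \<open>v\<close> near \<open>l\<close>, whereas the
  Fourier coefficient averages over a centred cube. The constant \<open>c\<close> shared by all
  boxes links the two: it is shown small on the box near \<open>l\<close> and then used on the
  cube.\<close>

lemma B_almost_periodic_cube_mean_tendsto_0:
  fixes f :: "real ^ 'n \<Rightarrow> complex" and F :: "complex ^ 'n \<Rightarrow> complex"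
  assumes \<sigma>: "\<sigma> > 0" and ap: "B_almost_periodic f" and F: "entire_several F"
    and ext: "\<And>x. F (complexify x) = f x"
    and growth: "\<And>z. cmod (F z) \<le> C * exp (\<sigma> * norm z)"
    and l: "norm l > \<sigma>"
  shows "((\<lambda>T. integral (cube 1) (\<lambda>v. f (T *\<^sub>R v) * scaled_char l T v)) \<longlongrightarrow> 0) at_top"
proof -
  have C: "C \<ge> 0" using order_trans[OF norm_ge_zero growth[of 0]] by simp
  have contf: "continuous_on UNIV f"
    using entire_several_continuous_complexify[OF F] by (simp add: ext)
  have lpos: "norm l > 0" using l \<sigma> by linarith
  \<comment> \<open>\<open>s\<close> is the sine of the rotation angle. On the ray the exponential
    factor contributes \<open>- r * s * (v \<bullet> l)\<close> to the exponent, so the total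
    exponent is \<open>- h v * r\<close>; the lower bound on \<open>s\<close> makes
    \<open>h l\<close> positive.\<close>
  obtain s where s: "\<sigma> / norm l < s" "s < 1"
    using dense[of "\<sigma> / norm l" 1] l lpos by auto
  have s0: "s > 0" using s(1) divide_pos_pos[OF \<sigma> lpos] by linarith
  define \<phi> where "\<phi> = arcsin s"
  have sin: "sin \<phi> = s" using s s0 by (simp add: \<phi>_def)
  have \<phi>: "0 < \<phi>" "\<phi> < pi / 2"
    using arcsin_lt_bounded[of s] arcsin_less_arcsin[of 0 s] s s0 by (auto simp: \<phi>_def)
  define h where "h v = s * (v \<bullet> l) - \<sigma> * norm v" for v
  define \<eta> where "\<eta> = h l / 2"
  have hl: "h l > 0"
  proof -
    have "\<sigma> < s * norm l" using s(1) lpos by (simp add: field_simps)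
    then have "\<sigma> * norm l < s * norm l * norm l" using lpos by simp
    then show ?thesis by (simp add: h_def dot_square_norm power2_eq_square)
  qed
  then have \<eta>: "\<eta> > 0" by (simp add: \<eta>_def)
  \<comment> \<open>By continuity \<open>h\<close> exceeds half of \<open>h l\<close> on a whole box
    around \<open>l\<close>, which gives one decay rate \<eta> for all its points.\<close>
  have op: "open {v. \<eta> < h v}"
    unfolding h_def by (intro open_Collect_less continuous_intros)
  have "l \<in> {v. \<eta> < h v}" using hl by (simp add: \<eta>_def)
  then obtain p q where pq: "cbox p q \<subseteq> {v. \<eta> < h v}" "l \<in> box p q" "\<forall>i\<in>Basis. p \<bullet> i < q \<bullet> i"
    by (rule open_contains_cbox[OF op])
  define V where "V = measure lborel (cbox p q)"
  have V: "V > 0"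
    using pq(3) unfolding V_def by (intro content_pos_lt) auto
  obtain M where M: "M > 0" "\<And>v. v \<in> cbox p q \<Longrightarrow> norm v \<le> M"
    using bounded_cbox[of p q] bounded_pos by blast
  have sub: "cbox p q \<subseteq> cube M"
  proof
    fix v assume "v \<in> cbox p q"
    then have "- M \<le> v $ i \<and> v $ i \<le> M" for i
      using M(2)[of v] component_le_norm_cart[of v i] by linarith
    then show "v \<in> cube M" by (simp add: cube_def mem_box_cart)
  qed
  define G where "G v t = F (\<chi> i. t * complexify v $ i) * exp (- \<i> * t * of_real (v \<bullet> l))" for v t
  have G_real: "G v (of_real t) = f (t *\<^sub>R v) * scaled_char l t v" for v t
  proof -
    have "(\<chi> i. complex_of_real t * complexify v $ i) = complexify (t *\<^sub>R v)"
      by (simp add: complexify_def vec_eq_iff)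
    then show ?thesis by (simp add: G_def scaled_char_def ext mult.assoc)
  qed
  have contG: "continuous_on (cbox p q \<times> UNIV) (\<lambda>(v, t). G v (complex_of_real t))"
  proof -
    have "continuous_on (cbox p q \<times> UNIV) (\<lambda>z. f (snd z *\<^sub>R fst z))"
      by (rule continuous_on_compose2[OF contf]) (auto intro!: continuous_intros)
    then show ?thesis
      unfolding G_real split_beta' scaled_char_def by (intro continuous_intros)
  qed
  have holoG: "G v holomorphic_on UNIV" for v
    unfolding G_def by (intro holomorphic_intros entire_several_line[OF F])
  have norm_G: "norm (G v t) \<le> C * exp (\<sigma> * (norm t * norm v) + Re (- \<i> * t * of_real (v \<bullet> l)))" for v t
  proof -
    have "norm (G v t) \<le> C * exp (\<sigma> * (norm t * norm v)) * exp (Re (- \<i> * t * of_real (v \<bullet> l)))"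
      unfolding G_def norm_mult norm_exp_eq_Re
      using growth[of "\<chi> i. t * complexify v $ i"] unfolding norm_scaled_complexify
      by (intro mult_right_mono) auto
    then show ?thesis by (simp add: exp_add mult.assoc)
  qed
  have growthG: "norm (G v t) \<le> C * exp ((\<sigma> + norm l) * M * norm t)" if v: "v \<in> cbox p q" for v t
  proof -
    have "Re (- \<i> * t * of_real (v \<bullet> l)) \<le> norm (- \<i> * t * of_real (v \<bullet> l))" by (rule complex_Re_le_cmod)
    also have "\<dots> = norm t * \<bar>v \<bullet> l\<bar>" by (simp add: norm_mult)
    also have "\<dots> \<le> norm t * (norm v * norm l)" by (intro mult_left_mono Cauchy_Schwarz_ineq2) auto
    finally have "\<sigma> * (norm t * norm v) + Re (- \<i> * t * of_real (v \<bullet> l)) \<le> (\<sigma> + norm l) * norm v * norm t"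
      by (simp add: algebra_simps)
    also have "\<dots> \<le> (\<sigma> + norm l) * M * norm t"
      using M(2)[OF v] \<sigma> by (intro mult_right_mono mult_left_mono) auto
    finally show ?thesis using C by (intro order_trans[OF norm_G] mult_left_mono) simp_all
  qed
  have decayG: "norm (G v (of_real r * cis (-\<phi>))) \<le> C * exp (- \<eta> * r)" if v: "v \<in> cbox p q" and r: "r > 0" for v r
  proof -
    have "\<sigma> * (norm (of_real r * cis (-\<phi>)) * norm v) + Re (- \<i> * (of_real r * cis (-\<phi>)) * of_real (v \<bullet> l)) = - h v * r"
      using r by (simp add: norm_mult h_def sin algebra_simps)
    also have "\<dots> \<le> - \<eta> * r" using pq(1) v r by auto
    finally show ?thesis using C by (intro order_trans[OF norm_G] mult_left_mono) simp_all
  qed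
  \<comment> \<open>Collects the two multiples of \<epsilon> in the final estimate: the first from
    comparing the cube mean with \<open>c\<close>, the second from the bound on \<open>c\<close>
    itself.\<close>
  define K where "K = 2 * 2 ^ CARD('n) + 2 * (2 * M) ^ CARD('n) / V * measure lborel (cube 1 :: (real ^ 'n) set)"
  have K: "K > 0" using M V by (simp add: K_def add_pos_nonneg)
  show ?thesis
  proof (rule tendstoI)
    fix e :: real assume e: "e > 0"
    define \<epsilon> where "\<epsilon> = e / (2 * K)"
    have \<epsilon>: "\<epsilon> > 0" "K * \<epsilon> < e" using e K by (simp_all add: \<epsilon>_def)
    obtain c where c: "\<And>a b M. M > 0 \<Longrightarrow> cbox a b \<subseteq> cube M \<Longrightarrow>
     (\<forall>\<^sub>F T in at_top. norm (integral (cbox a b) (\<lambda>v. f (T *\<^sub>R v) * scaled_char l T v) - c * of_real (measure lborel (cbox a b)))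
        \<le> 2 * (2 * M) ^ CARD('n) * \<epsilon>)"
      using B_almost_periodic_box_mean[OF contf ap \<epsilon>(1), of l] by blast
    \<comment> \<open>The contour argument applies to the small box with
      \<open>c * of_real V\<close> as approximate mean; dividing by \<open>V > 0\<close> then bounds
      \<open>c\<close>.\<close>
    have "norm (c * of_real V) \<le> 2 * (2 * M) ^ CARD('n) * \<epsilon>"
      using c[OF M(1) sub]
      by (intro norm_asymptotic_mean_le[OF contG holoG growthG decayG \<phi> \<eta>]) (auto simp: G_real V_def)
    then have cn: "norm c \<le> 2 * (2 * M) ^ CARD('n) / V * \<epsilon>"
      using V by (simp add: norm_mult field_simps)
    have cb: "norm (c * of_real (measure lborel (cube 1 :: (real ^ 'n) set)))
        \<le> 2 * (2 * M) ^ CARD('n) / V * \<epsilon> * measure lborel (cube 1 :: (real ^ 'n) set)"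
      unfolding norm_mult norm_of_real abs_of_nonneg[OF measure_nonneg]
      by (rule mult_right_mono[OF cn measure_nonneg])
    have "\<forall>\<^sub>F T in at_top. norm (integral (cube 1) (\<lambda>v. f (T *\<^sub>R v) * scaled_char l T v) - c * of_real (measure lborel (cube 1 :: (real ^ 'n) set)))
        \<le> 2 * 2 ^ CARD('n) * \<epsilon>"
      using c[of 1 "\<chi> i. -1" "\<chi> i. 1"] by (simp add: cube_def)
    then show "\<forall>\<^sub>F T in at_top. dist (integral (cube 1) (\<lambda>v. f (T *\<^sub>R v) * scaled_char l T v)) 0 < e"
    proof eventually_elim
      case (elim T)
      have "norm (integral (cube 1) (\<lambda>v. f (T *\<^sub>R v) * scaled_char l T v))
        \<le> norm (integral (cube 1) (\<lambda>v. f (T *\<^sub>R v) * scaled_char l T v) - c * of_real (measure lborel (cube 1 :: (real ^ 'n) set)))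
         + norm (c * of_real (measure lborel (cube 1 :: (real ^ 'n) set)))"
        by norm
      also have "\<dots> \<le> K * \<epsilon>" using add_mono[OF elim cb] by (simp add: K_def algebra_simps)
      finally show ?case using \<epsilon>(2) by simp
    qed
  qed
qed

theorem theorem1:
  fixes f :: "real ^ 'n \<Rightarrow> complex" and F :: "complex ^ 'n \<Rightarrow> complex"
    and \<sigma> C\<^sub>0 :: real
  assumes "\<sigma> > 0" and "C\<^sub>0 > 0"
    and "B_almost_periodic f"
    and "entire_several F"
    and "\<And>x. F (complexify x) = f x"
    and "\<And>z. cmod (F z) \<le> C\<^sub>0 * exp (\<sigma> * norm z)"
  shows "spectrum_ap f \<subseteq> {l. norm l \<le> \<sigma>}"
proof -
  have "fourier_coeff l f = 0" if l: "norm l > \<sigma>" for l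
  proof -
    have contf: "continuous_on UNIV f"
      using entire_several_continuous_complexify[OF assms(4)] by (simp add: assms(5))
    let ?m = "\<lambda>T::real. integral (cube T) (\<lambda>x. f x * exp (- \<i> * complex_of_real (x \<bullet> l))) / of_real ((2 * T) ^ CARD('n))"
    \<comment> \<open>The dilation contributes \<open>T ^ CARD('n)\<close>, which cancels against
      the normalisation \<open>(2 * T) ^ CARD('n)\<close> and leaves
      \<open>2 ^ CARD('n)\<close>.\<close>
    have "((\<lambda>T. integral (cube 1) (\<lambda>v. f (T *\<^sub>R v) * scaled_char l T v) / 2 ^ CARD('n)) \<longlongrightarrow> 0 / 2 ^ CARD('n)) at_top"
      by (intro tendsto_intros B_almost_periodic_cube_mean_tendsto_0[OF assms(1,3-6) l]) simp
    then have "(?m \<longlongrightarrow> 0 / 2 ^ CARD('n)) at_top"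
    proof (rule Lim_transform_eventually)
      show "\<forall>\<^sub>F T in at_top. integral (cube 1) (\<lambda>v. f (T *\<^sub>R v) * scaled_char l T v) / 2 ^ CARD('n) = ?m T"
        using eventually_gt_at_top[of 0]
      proof eventually_elim
        case (elim T)
        have "continuous_on UNIV (\<lambda>x. f x * exp (- \<i> * complex_of_real (x \<bullet> l)))"
          by (intro continuous_intros contf)
        from integral_cube_scale[OF this elim, of 1] show ?case
          using elim by (simp add: scaled_char_def scaleR_conv_of_real power_mult_distrib field_simps)
      qed
    qed
    then have "(?m \<longlongrightarrow> 0) at_top" by simp
    \<comment> \<open>\<open>Lim\<close> is specified only through convergence, so the limit just
      established is what determines its value.\<close>
    then show ?thesis unfolding fourier_coeff_def by (intro tendsto_Lim) auto
  qed
  then show ?thesis unfolding spectrum_ap_def by force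
qed

end
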